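(* Let $L \in \{\mathbf{K}, \mathbf{KTB}\}$. Then there exists a polynomial-time computable mapping $e$ from modal formulas to modal formulas containing at most one propositional variable such that for every modal formula $\varphi$, $\varphi \in L$ if and only if $e(\varphi) \in L$ (i.e., $e$ embeds $L$ into its single-variable fragment).
   Context: The propositional modal language has countably many propositional variables $p_1, p_2, \ldots$, the constant $\bot$, the connective $\rightarrow$ and the modal operator $\Box$; other connectives are defined as usual. Formulas are evaluated in Kripke models in the standard way. $\mathbf{K}$ is the set of formulas valid on all Kripke frames; $\mathbf{KTB}$ is the set of formulas valid on all frames whose accessibility relation is reflexive and symmetric. The single-variable fragment of $L$ is the set of formulas of $L$ containing at most one propositional variable. *)

theory Defs
  imports "HOL-Library.Countable_Set" "HOL-Computational_Algebra.Polynomial"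
begin

section \<open>Modal formulas and Kripke semantics\<close>

text \<open>\<open>Var i\<close> is the variable \<open>p\<^sub>i\<^sub>+\<^sub>1\<close>.\<close>

datatype fm = Var nat | Bot | Imp fm fm | Box fm

primrec vars :: "fm \<Rightarrow> nat set" where
  "vars (Var i) = {i}"
| "vars Bot = {}"
| "vars (Imp \<phi> \<psi>) = vars \<phi> \<union> vars \<psi>"
| "vars (Box \<phi>) = vars \<phi>"

lemma finite_vars [simp]: "finite (vars \<phi>)"
  by (induction \<phi>) auto

definition single_variable :: "fm set" where
  "single_variable = {\<phi>. card (vars \<phi>) \<le> 1}"

definition is_frame :: "'w set \<Rightarrow> ('w \<times> 'w) set \<Rightarrow> bool" where
  "is_frame W R \<longleftrightarrow> W \<noteq> {} \<and> R \<subseteq> W \<times> W"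

primrec sat :: "'w set \<Rightarrow> ('w \<times> 'w) set \<Rightarrow> (nat \<Rightarrow> 'w set) \<Rightarrow> 'w \<Rightarrow> fm \<Rightarrow> bool" where
  "sat W R V w (Var i) \<longleftrightarrow> w \<in> V i"
| "sat W R V w Bot \<longleftrightarrow> False"
| "sat W R V w (Imp \<phi> \<psi>) \<longleftrightarrow> (sat W R V w \<phi> \<longrightarrow> sat W R V w \<psi>)"
| "sat W R V w (Box \<phi>) \<longleftrightarrow> (\<forall>v\<in>W. (w, v) \<in> R \<longrightarrow> sat W R V v \<phi>)"

definition valid_on :: "'w set \<Rightarrow> ('w \<times> 'w) set \<Rightarrow> fm \<Rightarrow> bool" where
  "valid_on W R \<phi> \<longleftrightarrow> (\<forall>V. (\<forall>i. V i \<subseteq> W) \<longrightarrow> (\<forall>w\<in>W. sat W R V w \<phi>))"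

text \<open>
  HOL cannot quantify over types inside a formula, so the worlds of the frames in the two
  definitions below are drawn from \<open>nat\<close>. The facts \<open>logic_K_iff\<close> and \<open>logic_KTB_iff\<close>
  show that this loses nothing: membership is the same as validity on all frames
  with worlds from any given infinite type, and it implies validity on all frames with worlds
  from an arbitrary type (\<open>logic_K_valid\<close>, \<open>logic_KTB_valid\<close>).
\<close>

definition logic_K :: "fm set" where
  "logic_K = {\<phi>. \<forall>(W :: nat set) R. is_frame W R \<longrightarrow> valid_on W R \<phi>}"

definition logic_KTB :: "fm set" where
  "logic_KTB = {\<phi>. \<forall>(W :: nat set) R.
     is_frame W R \<and> refl_on W R \<and> sym R \<longrightarrow> valid_on W R \<phi>}"


subsection \<open>Independence of the type of worlds\<close>

instance fm :: countable
  by countable_datatype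

lemma countable_submodel:
  fixes W :: "'w set"
  assumes w: "w \<in> W"
  obtains C where "C \<subseteq> W" "countable C" "w \<in> C"
    "\<And>x \<phi>. x \<in> C \<Longrightarrow> sat C (R \<inter> C \<times> C) (\<lambda>i. V i \<inter> C) x \<phi> \<longleftrightarrow> sat W R V x \<phi>"
proof -
  define f where "f x \<psi> = (if \<exists>v\<in>W. (x, v) \<in> R \<and> \<not> sat W R V v \<psi>
    then SOME v. v \<in> W \<and> (x, v) \<in> R \<and> \<not> sat W R V v \<psi> else x)" for x \<psi>
  have f: "f x \<psi> \<in> W \<and> (x, f x \<psi>) \<in> R \<and> \<not> sat W R V (f x \<psi>) \<psi>"
    if "v \<in> W" "(x, v) \<in> R" "\<not> sat W R V v \<psi>" for x v \<psi>
  proof -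
    have "f x \<psi> = (SOME v. v \<in> W \<and> (x, v) \<in> R \<and> \<not> sat W R V v \<psi>)"
      using that unfolding f_def by auto
    then show ?thesis
      using someI[of "\<lambda>v. v \<in> W \<and> (x, v) \<in> R \<and> \<not> sat W R V v \<psi>" v] that by metis
  qed
  have fW: "f x \<psi> \<in> W" if "x \<in> W" for x \<psi>
    using that f by (cases "\<exists>v\<in>W. (x, v) \<in> R \<and> \<not> sat W R V v \<psi>") (blast, auto simp: f_def)
  define C where "C = range (foldl f w)"
  have "foldl f w \<psi>s \<in> W" for \<psi>s
    by (induction \<psi>s rule: rev_induct) (auto simp: w fW)
  then have CW: "C \<subseteq> W" by (auto simp: C_def)
  have cl: "f x \<psi> \<in> C" if x: "x \<in> C" for x \<psi>
  proof -
    obtain \<psi>s where "x = foldl f w \<psi>s" using x unfolding C_def by blast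
    then have "f x \<psi> = foldl f w (\<psi>s @ [\<psi>])" by simp
    then show ?thesis unfolding C_def by blast
  qed
  have "w = foldl f w []" by simp
  then have wC: "w \<in> C" unfolding C_def by blast
  have "sat C (R \<inter> C \<times> C) (\<lambda>i. V i \<inter> C) x \<phi> \<longleftrightarrow> sat W R V x \<phi>" if "x \<in> C" for x \<phi>
    using that
  proof (induction \<phi> arbitrary: x)
    case (Box \<phi>)
    have "\<exists>v\<in>C. (x, v) \<in> R \<and> \<not> sat W R V v \<phi>"
      if "v \<in> W" "(x, v) \<in> R" "\<not> sat W R V v \<phi>" for v
      using f[OF that] cl[OF Box.prems] by blast
    then show ?case using Box CW by auto
  qed auto
  then show ?thesis using that[of C] CW wC by (auto simp: C_def)
qed

lemma sat_image:
  assumes "inj_on h W" "x \<in> W" "R \<subseteq> W \<times> W" "\<And>i. V i \<subseteq> W"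
  shows "sat (h ` W) (map_prod h h ` R) (\<lambda>i. h ` V i) (h x) \<phi> \<longleftrightarrow> sat W R V x \<phi>"
  using assms(2)
proof (induction \<phi> arbitrary: x)
  case (Var i)
  then show ?case using inj_on_image_mem_iff[OF assms(1) Var assms(4)] by simp
next
  case (Box \<phi>)
  have "(h x, h v) \<in> map_prod h h ` R \<longleftrightarrow> (x, v) \<in> R" if "v \<in> W" for v
  proof
    assume "(h x, h v) \<in> map_prod h h ` R"
    then obtain a b where ab: "(a, b) \<in> R" "h x = h a" "h v = h b" by auto
    then have "a \<in> W" "b \<in> W" using assms(3) by auto
    then have "x = a" "v = b"
      using ab inj_onD[OF assms(1)] Box.prems that by blast+
    then show "(x, v) \<in> R" using ab by simp
  qed force
  then show ?case using Box by auto
qed auto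

lemma transfer_countermodel:
  fixes W :: "'a set"
  assumes fr: "is_frame W R" and nv: "\<not> valid_on W R \<phi>" and inf: "infinite (UNIV :: 'b set)"
  obtains W' :: "'b set" and R' where "is_frame W' R'" "\<not> valid_on W' R' \<phi>"
    "refl_on W R \<Longrightarrow> refl_on W' R'" "sym R \<Longrightarrow> sym R'"
proof -
  obtain V w where w: "w \<in> W" and ns: "\<not> sat W R V w \<phi>"
    using nv unfolding valid_on_def by auto
  obtain C where C: "C \<subseteq> W" "countable C" "w \<in> C" and
    eq: "\<And>x \<phi>. x \<in> C \<Longrightarrow> sat C (R \<inter> C \<times> C) (\<lambda>i. V i \<inter> C) x \<phi> \<longleftrightarrow> sat W R V x \<phi>"
    using countable_submodel[OF w, of R V] by blast
  obtain g :: "nat \<Rightarrow> 'b" where g: "inj g" using inf infinite_countable_subset by blast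
  define h where "h = g \<circ> to_nat_on C"
  have h: "inj_on h C"
    unfolding h_def using C(2) g by (meson comp_inj_on inj_on_subset inj_on_to_nat_on subset_UNIV)
  let ?R = "R \<inter> C \<times> C"
  have ns': "\<not> sat (h ` C) (map_prod h h ` ?R) (\<lambda>i. h ` (V i \<inter> C)) (h w) \<phi>"
    using sat_image[OF h C(3), of ?R "\<lambda>i. V i \<inter> C" \<phi>] eq[OF C(3)] ns by auto
  have 1: "\<not> valid_on (h ` C) (map_prod h h ` ?R) \<phi>"
  proof
    assume "valid_on (h ` C) (map_prod h h ` ?R) \<phi>"
    moreover have "\<forall>i. h ` (V i \<inter> C) \<subseteq> h ` C" by auto
    ultimately have "\<forall>x\<in>h ` C. sat (h ` C) (map_prod h h ` ?R) (\<lambda>i. h ` (V i \<inter> C)) x \<phi>"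
      unfolding valid_on_def by simp
    then show False using ns' C(3) by simp
  qed
  show ?thesis
  proof (rule that[OF _ 1])
    show "is_frame (h ` C) (map_prod h h ` ?R)" using C(3) by (auto simp: is_frame_def)
    show "refl_on (h ` C) (map_prod h h ` ?R)" if "refl_on W R"
    proof (rule refl_onI)
      fix y assume "y \<in> h ` C"
      then obtain x where x: "x \<in> C" "y = h x" by blast
      then have "(x, x) \<in> ?R" using that C(1) by (auto dest: refl_onD)
      then have "map_prod h h (x, x) \<in> map_prod h h ` ?R" by (rule imageI)
      then show "(y, y) \<in> map_prod h h ` ?R" using x by simp
    qed
    show "sym (map_prod h h ` ?R)" if "sym R"
    proof (rule symI)
      fix y z assume "(y, z) \<in> map_prod h h ` ?R"
      then obtain a b where ab: "(a, b) \<in> ?R" "y = h a" "z = h b" by auto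
      then have "(b, a) \<in> ?R" using that by (auto dest: symD)
      then have "map_prod h h (b, a) \<in> map_prod h h ` ?R" by (rule imageI)
      then show "(z, y) \<in> map_prod h h ` ?R" using ab by simp
    qed
  qed
qed

lemma logic_K_valid:
  fixes W :: "'w set"
  assumes "\<phi> \<in> logic_K" "is_frame W R"
  shows "valid_on W R \<phi>"
proof (rule ccontr)
  assume nv: "\<not> valid_on W R \<phi>"
  show False
    by (rule transfer_countermodel[OF assms(2) nv infinite_UNIV_nat])
      (use assms(1) in \<open>simp add: logic_K_def\<close>)
qed

lemma logic_KTB_valid:
  fixes W :: "'w set"
  assumes "\<phi> \<in> logic_KTB" "is_frame W R" "refl_on W R" "sym R"
  shows "valid_on W R \<phi>"
proof (rule ccontr)
  assume nv: "\<not> valid_on W R \<phi>"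
  show False
    by (rule transfer_countermodel[OF assms(2) nv infinite_UNIV_nat])
      (use assms(1,3,4) in \<open>simp add: logic_KTB_def\<close>)
qed

lemma logic_K_iff:
  assumes "infinite (UNIV :: 'w set)"
  shows "\<phi> \<in> logic_K \<longleftrightarrow> (\<forall>(W :: 'w set) R. is_frame W R \<longrightarrow> valid_on W R \<phi>)"
proof
  assume r: "\<forall>(W :: 'w set) R. is_frame W R \<longrightarrow> valid_on W R \<phi>"
  have "valid_on W R \<phi>" if fr: "is_frame W R" for W :: "nat set" and R
  proof (rule ccontr)
    assume nv: "\<not> valid_on W R \<phi>"
    show False
      by (rule transfer_countermodel[OF fr nv assms]) (use r in simp)
  qed
  then show "\<phi> \<in> logic_K" by (simp add: logic_K_def)
qed (simp add: logic_K_valid)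

lemma logic_KTB_iff:
  assumes "infinite (UNIV :: 'w set)"
  shows "\<phi> \<in> logic_KTB \<longleftrightarrow>
    (\<forall>(W :: 'w set) R. is_frame W R \<and> refl_on W R \<and> sym R \<longrightarrow> valid_on W R \<phi>)"
proof
  assume r: "\<forall>(W :: 'w set) R. is_frame W R \<and> refl_on W R \<and> sym R \<longrightarrow> valid_on W R \<phi>"
  have "valid_on W R \<phi>" if fr: "is_frame W R" and rs: "refl_on W R" "sym R"
    for W :: "nat set" and R
  proof (rule ccontr)
    assume nv: "\<not> valid_on W R \<phi>"
    show False
      by (rule transfer_countermodel[OF fr nv assms]) (use r rs in simp)
  qed
  then show "\<phi> \<in> logic_KTB" by (simp add: logic_KTB_def)
qed (simp add: logic_KTB_valid)


section \<open>Deterministic multi-tape Turing machines\<close>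

text \<open>
  States are natural numbers. A tape symbol is either \<open>Inl a\<close> for a letter \<open>a\<close> of the
  input/output alphabet, or an auxiliary symbol \<open>Inr j\<close>; the blank is \<open>Inr 0\<close>. The transition
  function maps a state and the list of scanned symbols (one per tape) to a
  new state and, for each tape, the symbol to write and the head movement. Tapes are infinite in
  both directions.
\<close>

type_synonym 'a symbol = "'a + nat"

abbreviation blank :: "'a symbol" where
  "blank \<equiv> Inr 0"

datatype move = Left | Stay | Right

primrec offset :: "move \<Rightarrow> int" where
  "offset Left = -1"
| "offset Stay = 0"
| "offset Right = 1"

record 'a tm =
  tapes :: nat
  states :: "nat set"
  alphabet :: "'a symbol set"
  start :: nat
  halt :: nat
  trans :: "nat \<Rightarrow> 'a symbol list \<Rightarrow> nat \<times> ('a symbol \<times> move) list"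

definition is_tm :: "'a tm \<Rightarrow> bool" where
  "is_tm M \<longleftrightarrow>
     tapes M \<ge> 1 \<and>
     finite (states M) \<and> start M \<in> states M \<and> halt M \<in> states M \<and>
     finite (alphabet M) \<and> range Inl \<subseteq> alphabet M \<and> blank \<in> alphabet M \<and>
     (\<forall>q \<in> states M. \<forall>ss. set ss \<subseteq> alphabet M \<and> length ss = tapes M \<longrightarrow>
        (case trans M q ss of (q', acts) \<Rightarrow>
           q' \<in> states M \<and> length acts = tapes M \<and> fst ` set acts \<subseteq> alphabet M))"

text \<open>A tape is given by its contents and the position of the head.\<close>

type_synonym 'a tape = "(int \<Rightarrow> 'a symbol) \<times> int"

type_synonym 'a config = "nat \<times> 'a tape list"

definition scanned :: "'a tape \<Rightarrow> 'a symbol" where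
  "scanned t = fst t (snd t)"

definition act :: "'a symbol \<times> move \<Rightarrow> 'a tape \<Rightarrow> 'a tape" where
  "act a t = ((fst t)(snd t := fst a), snd t + offset (snd a))"

definition step :: "'a tm \<Rightarrow> 'a config \<Rightarrow> 'a config" where
  "step M = (\<lambda>(q, ts).
     if q = halt M then (q, ts)
     else case trans M q (map scanned ts) of (q', acts) \<Rightarrow> (q', map2 act acts ts))"

definition contents :: "'a list \<Rightarrow> int \<Rightarrow> 'a symbol" where
  "contents xs i = (if 0 \<le> i \<and> nat i < length xs then Inl (xs ! nat i) else blank)"

text \<open>The first tape holds the input, and the last tape holds the output.\<close>

definition initial :: "'a tm \<Rightarrow> 'a list \<Rightarrow> 'a config" where
  "initial M xs = (start M, (contents xs, 0) # replicate (tapes M - 1) (contents [], 0))"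

definition outputs_within :: "'a tm \<Rightarrow> 'a list \<Rightarrow> 'a list \<Rightarrow> nat \<Rightarrow> bool" where
  "outputs_within M xs ys t \<longleftrightarrow>
     (case (step M ^^ t) (initial M xs) of (q, ts) \<Rightarrow>
        q = halt M \<and> fst (last ts) = contents ys)"


section \<open>Polynomial-time computable mappings on formulas\<close>

text \<open>
  Formulas are written in prefix (Polish) notation; the index of a variable is
  written in binary, most significant digit first.
\<close>

datatype letter = LVar | LBot | LImp | LBox | D0 | D1

fun binary :: "nat \<Rightarrow> letter list" where
  "binary n = (if n = 0 then [D0] else if n = 1 then [D1]
     else binary (n div 2) @ [if even n then D0 else D1])"

declare binary.simps [simp del]

primrec code :: "fm \<Rightarrow> letter list" where
  "code (Var i) = LVar # binary i"
| "code Bot = [LBot]"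
| "code (Imp \<phi> \<psi>) = LImp # code \<phi> @ code \<psi>"
| "code (Box \<phi>) = LBox # code \<phi>"

definition poly_time_computable :: "(fm \<Rightarrow> fm) \<Rightarrow> bool" where
  "poly_time_computable f \<longleftrightarrow>
     (\<exists>(M :: letter tm) (p :: nat poly). is_tm M \<and>
        (\<forall>\<phi>. outputs_within M (code \<phi>) (code (f \<phi>)) (poly p (length (code \<phi>)))))"


subsection \<open>Unique readability of the encoding\<close>

lemma binary_rec:
  "binary 0 = [D0]" "binary (Suc 0) = [D1]"
  "n \<ge> 2 \<Longrightarrow> binary n = binary (n div 2) @ [if even n then D0 else D1]"
  by (subst binary.simps, simp)+

lemma binary_digits: "set (binary n) \<subseteq> {D0, D1}"
proof (induction n rule: less_induct)
  case (less n)
  consider "n = 0" | "n = Suc 0" | "n \<ge> 2" by linarith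
  then show ?case
    by cases (use less[of "n div 2"] in \<open>auto simp: binary_rec\<close>)
qed

lemma binary_nonempty: "binary n \<noteq> []"
proof -
  consider "n = 0" | "n = Suc 0" | "n \<ge> 2" by linarith
  then show ?thesis by cases (auto simp: binary_rec)
qed

lemma inj_binary: "binary m = binary n \<Longrightarrow> m = n"
proof (induction m arbitrary: n rule: less_induct)
  case (less m)
  have m: "m = 0 \<or> m = Suc 0 \<or> m \<ge> 2" and n: "n = 0 \<or> n = Suc 0 \<or> n \<ge> 2" by linarith+
  show ?case
  proof (cases "m \<ge> 2 \<and> n \<ge> 2")
    case True
    then have "binary (m div 2) = binary (n div 2)" and par: "even m \<longleftrightarrow> even n"
      using less.prems by (simp_all add: binary_rec(3) split: if_splits)
    then have "m div 2 = n div 2" using less.IH[of "m div 2" "n div 2"] True by simp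
    moreover have "m mod 2 = n mod 2" using par by presburger
    ultimately show ?thesis by (metis div_mult_mod_eq)
  next
    case False
    then show ?thesis
      using m n less.prems binary_nonempty[of "m div 2"] binary_nonempty[of "n div 2"]
      by (elim disjE) (auto simp: binary_rec)
  qed
qed

lemma hd_code: "code \<phi> \<noteq> [] \<and> hd (code \<phi>) \<notin> {D0, D1}"
  by (cases \<phi>) auto

lemma code_append_inj:
  assumes "code \<phi> @ xs = code \<psi> @ ys"
    and "xs = [] \<or> hd xs \<notin> {D0, D1}" "ys = [] \<or> hd ys \<notin> {D0, D1}"
  shows "\<phi> = \<psi> \<and> xs = ys"
  using assms
proof (induction \<phi> arbitrary: \<psi> xs ys)
  case (Var i)
  then obtain j where j: "\<psi> = Var j" by (cases \<psi>) auto
  let ?P = "\<lambda>l. l \<in> {D0, D1}"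
  have tw: "takeWhile ?P (binary n @ zs) = binary n" if "zs = [] \<or> hd zs \<notin> {D0, D1}" for n zs
  proof -
    have "takeWhile ?P zs = []" using that by (cases zs) auto
    then show ?thesis using binary_digits[of n] by (subst takeWhile_append2) auto
  qed
  have "binary i @ xs = binary j @ ys" using Var.prems(1) j by simp
  then have "binary i = binary j" using tw Var.prems(2,3) by metis
  then show ?case using j Var.prems(1) inj_binary by simp
next
  case Bot
  then show ?case by (cases \<psi>) auto
next
  case (Imp \<phi>1 \<phi>2)
  obtain \<psi>1 \<psi>2 where p: "\<psi> = Imp \<psi>1 \<psi>2" using Imp.prems(1) by (cases \<psi>) auto
  have e: "code \<phi>1 @ (code \<phi>2 @ xs) = code \<psi>1 @ (code \<psi>2 @ ys)" using Imp.prems(1) p by simp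
  have "\<phi>1 = \<psi>1 \<and> code \<phi>2 @ xs = code \<psi>2 @ ys"
    using Imp.IH(1)[OF e] hd_code[of \<phi>2] hd_code[of \<psi>2] by simp
  then show ?case using p Imp.IH(2) Imp.prems(2,3) by blast
next
  case (Box \<phi>)
  obtain \<psi>' where p: "\<psi> = Box \<psi>'" using Box.prems(1) by (cases \<psi>) auto
  then show ?case using Box.IH[of xs \<psi>' ys] Box.prems by simp
qed

lemma inj_code: "inj code"
  using code_append_inj[of _ "[]" _ "[]"] by (auto intro: injI)

end

theory Submission
  imports Defs
begin

text \<open>
  Worlds of the original model are those where \<open>p\<close> holds, and \<open>Box\<close> is relativised to \<open>p\<close>. The
  variable with index \<open>i\<close> becomes a formula saying that no path of worlds attached at a world with
  \<open>\<not> p\<close> spells the binary digits of \<open>i\<close>. A theorem stays a theorem, since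
  a model of the translation restricts to the worlds satisfying \<open>p\<close>, with the values of the
  translated variables as valuation. Conversely, a countermodel is extended by
  attaching to each world \<open>x\<close> a reflexive and symmetric path for each \<open>i\<close> whose variable is
  false at \<open>x\<close>. The frame conditions are preserved in both directions, so one translation serves
  both logics, and it is computed by a finite-state transducer.
\<close>

section \<open>Sequential transducers as Turing machines\<close>

lemma UNIV_letter: "(UNIV :: letter set) = {LVar, LBot, LImp, LBox, D0, D1}"
  using letter.exhaust by auto

instance letter :: finite
  by standard (simp add: UNIV_letter)

fun transduce :: "('s \<Rightarrow> 'a \<Rightarrow> 's \<times> 'b list) \<Rightarrow> ('s \<Rightarrow> 'b list) \<Rightarrow> 's \<Rightarrow> 'a list \<Rightarrow> 'b list" where
  "transduce \<delta> fin q [] = fin q"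
| "transduce \<delta> fin q (a # as) = snd (\<delta> q a) @ transduce \<delta> fin (fst (\<delta> q a)) as"

text \<open>
  A machine state is a transducer state (\<open>None\<close> once the input is exhausted) together with the
  word that still has to be written.
\<close>

type_synonym ('s, 'a) tstate = "'s option \<times> 'a list"

fun transducer_move :: "('s \<Rightarrow> 'a \<Rightarrow> 's \<times> 'a list) \<Rightarrow> ('s \<Rightarrow> 'a list) \<Rightarrow>
    ('s, 'a) tstate \<Rightarrow> 'a symbol \<Rightarrow> 'a symbol \<Rightarrow> ('s, 'a) tstate \<times> ('a symbol \<times> move) list" where
  "transducer_move \<delta> fin (q, x # xs) s t = ((q, xs), [(s, Stay), (Inl x, Right)])"
| "transducer_move \<delta> fin (Some q, []) (Inl a) t =
     ((Some (fst (\<delta> q a)), snd (\<delta> q a)), [(Inl a, Right), (t, Stay)])"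
| "transducer_move \<delta> fin (Some q, []) (Inr k) t = ((None, fin q), [(Inr k, Stay), (t, Stay)])"
| "transducer_move \<delta> fin (None, []) s t = ((None, []), [(s, Stay), (t, Stay)])"

text \<open>The bound \<open>K\<close> on pending words keeps the set of states finite.\<close>

definition transducer_tm ::
  "('s::finite \<Rightarrow> 'a::finite \<Rightarrow> 's \<times> 'a list) \<Rightarrow> ('s \<Rightarrow> 'a list) \<Rightarrow> 's \<Rightarrow> nat \<Rightarrow> 'a tm" where
  "transducer_tm \<delta> fin q0 K = \<lparr>tapes = 2,
     states = to_nat ` {s :: ('s, 'a) tstate. length (snd s) \<le> K},
     alphabet = insert blank (range Inl),
     start = to_nat (Some q0, [] :: 'a list), halt = to_nat (None :: 's option, [] :: 'a list),
     trans = (\<lambda>n ss. map_prod to_nat id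
       (transducer_move \<delta> fin (from_nat n) (ss ! 0) (ss ! 1)))\<rparr>"

lemma is_tm_transducer_tm:
  fixes \<delta> :: "'s::finite \<Rightarrow> 'a::finite \<Rightarrow> 's \<times> 'a list"
  assumes K: "\<And>q a. length (snd (\<delta> q a)) \<le> K" "\<And>q. length (fin q) \<le> K"
  shows "is_tm (transducer_tm \<delta> fin q0 K)"
proof -
  have "finite {s :: ('s, 'a) tstate. length (snd s) \<le> K}"
  proof -
    have "{s :: ('s, 'a) tstate. length (snd s) \<le> K} = UNIV \<times> {xs. set xs \<subseteq> UNIV \<and> length xs \<le> K}"
      by auto
    then show ?thesis
      using finite_lists_length_le[of "UNIV :: 'a set" K] by simp
  qed
  moreover have "case map_prod to_nat id (transducer_move \<delta> fin s (ss ! 0) (ss ! 1)) of (n, acts) \<Rightarrow>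
      n \<in> to_nat ` {s :: ('s, 'a) tstate. length (snd s) \<le> K} \<and> length acts = 2 \<and>
      fst ` set acts \<subseteq> insert blank (range Inl)"
    if "length (snd s) \<le> K" "set ss \<subseteq> insert blank (range Inl)" "length ss = 2" for s ss
  proof -
    have "ss ! 0 \<in> set ss" "ss ! 1 \<in> set ss" using that(3) by auto
    then have "ss ! 0 \<in> insert blank (range Inl)" "ss ! 1 \<in> insert blank (range Inl)"
      using that(2) by auto
    with that(1) K show ?thesis
      by (cases "(\<delta>, fin, s, ss ! 0, ss ! 1)" rule: transducer_move.cases) auto
  qed
  ultimately show ?thesis
    unfolding is_tm_def transducer_tm_def by auto
qed

definition transducer_config ::
  "'a::finite list \<Rightarrow> 's::finite option \<Rightarrow> 'a list \<Rightarrow> nat \<Rightarrow> 'a list \<Rightarrow> 'a config" where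
  "transducer_config xs q w k ys =
     (to_nat (q, w), [(contents xs, int k), (contents ys, int (length ys))])"

lemma contents_snoc: "(contents ys)(int (length ys) := Inl x) = contents (ys @ [x])"
  by (auto simp: contents_def fun_eq_iff nth_append)

lemma contents_nth: "k < length xs \<Longrightarrow> contents xs (int k) = Inl (xs ! k)"
  and contents_length: "contents xs (int (length xs)) = blank"
  by (simp_all add: contents_def)

context
  fixes \<delta> :: "'s::finite \<Rightarrow> 'a::finite \<Rightarrow> 's \<times> 'a list" and fin :: "'s \<Rightarrow> 'a list"
    and q0 :: 's and K :: nat
begin

private abbreviation "M \<equiv> transducer_tm \<delta> fin q0 K"

lemma step_emit:
  fixes q :: "'s option"
  shows "step M (transducer_config xs q (x # w) k ys) = transducer_config xs q w k (ys @ [x])"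
  by (simp add: step_def transducer_tm_def transducer_config_def scanned_def act_def contents_snoc)

lemma steps_emit:
  fixes q :: "'s option"
  shows "(step M ^^ length w) (transducer_config xs q w k ys) = transducer_config xs q [] k (ys @ w)"
  by (induction w arbitrary: ys) (simp_all add: step_emit funpow_Suc_right del: funpow.simps(2))

lemma step_read:
  assumes "k < length xs"
  shows "step M (transducer_config xs (Some q) [] k ys) =
     transducer_config xs (Some (fst (\<delta> q (xs ! k)))) (snd (\<delta> q (xs ! k))) (Suc k) ys"
  using assms
  by (simp add: step_def transducer_tm_def transducer_config_def scanned_def act_def
      contents_nth fun_upd_idem)

lemma step_end:
  "step M (transducer_config xs (Some q) [] (length xs) ys) =
     transducer_config xs (None :: 's option) (fin q) (length xs) ys"
  by (simp add: step_def transducer_tm_def transducer_config_def scanned_def act_def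
      contents_length fun_upd_idem)

lemma steps_halt:
  fixes xs ys :: "'a list"
  shows "(step M ^^ n) (transducer_config xs (None :: 's option) [] k ys) =
     transducer_config xs (None :: 's option) [] k ys"
  by (induction n) (simp_all add: step_def transducer_tm_def transducer_config_def)

text \<open>Each letter costs one step to read and at most \<open>K\<close> to write its word, and
  so does the closing blank. The halting configuration is a fixed point, so any larger
  \<open>n\<close> serves too.\<close>

lemma transducer_run:
  assumes K: "\<And>q a. length (snd (\<delta> q a)) \<le> K" "\<And>q. length (fin q) \<le> K"
    and "k \<le> length xs" "n \<ge> (length xs - k + 1) * (K + 1)"
  shows "(step M ^^ n) (transducer_config xs (Some q) [] k ys) =
     transducer_config xs (None :: 's option) [] (length xs) (ys @ transduce \<delta> fin q (drop k xs))"
  using assms(3,4)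
proof (induction "length xs - k" arbitrary: k q ys n)
  case 0
  then have k: "k = length xs" by simp
  have le: "n \<ge> length (fin q) + 1" using 0 K(2)[of q] by simp
  \<comment> \<open>Read from the right: one step for the blank, then writing \<open>fin q\<close>,
    then idling in the halting state.\<close>
  then have n: "n = (n - length (fin q) - 1) + (length (fin q) + 1)" by simp
  show ?case
    by (subst n, subst funpow_add)
      (simp add: k step_end steps_emit steps_halt funpow_Suc_right del: funpow.simps(2))
next
  case (Suc m)
  then have k: "k < length xs" by simp
  let ?q = "fst (\<delta> q (xs ! k))" and ?w = "snd (\<delta> q (xs ! k))"
  have m: "m = length xs - Suc k" using Suc.hyps(2) by simp
  have w: "length ?w \<le> K" by (rule K)
  have big: "n \<ge> (m + 1) * (K + 1) + (K + 1)"
    using Suc.prems(2) unfolding Suc.hyps(2)[symmetric] by simp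
  then obtain r where n: "n = r + (length ?w + 1)"
    using w by (metis add.commute add_le_mono1 le_add2 le_iff_add order_trans)
  have r: "r \<ge> (length xs - Suc k + 1) * (K + 1)"
    using big w unfolding m[symmetric] n by linarith
  show ?case
    by (subst n, subst funpow_add)
      (use k Suc.hyps(1)[OF m _ r] in \<open>simp add: step_read steps_emit funpow_Suc_right
        Cons_nth_drop_Suc[symmetric] del: funpow.simps(2)\<close>)
qed

end

theorem poly_time_computable_transduce:
  fixes \<delta> :: "'s::finite \<Rightarrow> letter \<Rightarrow> 's \<times> letter list"
  assumes f: "\<And>\<phi>. code (f \<phi>) = transduce \<delta> fin q0 (code \<phi>)"
  shows "poly_time_computable f"
proof -
  \<comment> \<open>States and letters are finitely many, so one \<open>K\<close> bounds all output
    words.\<close>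
  define K where "K = Max (range (\<lambda>(q, a). length (snd (\<delta> q a))) \<union> range (\<lambda>q. length (fin q)))"
  have K: "length (snd (\<delta> q a)) \<le> K" "length (fin q) \<le> K" for q a
    unfolding K_def by (rule Max_ge; force)+
  let ?M = "transducer_tm \<delta> fin q0 K" and ?p = "[:K + 1, K + 1:] :: nat poly"
  have "outputs_within ?M (code \<phi>) (code (f \<phi>)) (poly ?p (length (code \<phi>)))" for \<phi>
  proof -
    have "initial ?M (code \<phi>) = transducer_config (code \<phi>) (Some q0) [] 0 []"
      by (simp add: initial_def transducer_tm_def transducer_config_def numeral_2_eq_2)
    moreover have "poly ?p (length (code \<phi>)) \<ge> (length (code \<phi>) - 0 + 1) * (K + 1)"
      by (simp add: algebra_simps)
    ultimately have "(step ?M ^^ poly ?p (length (code \<phi>))) (initial ?M (code \<phi>)) =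
        transducer_config (code \<phi>) (None :: 's option) [] (length (code \<phi>)) (code (f \<phi>))"
      using transducer_run[of \<delta> K fin 0 "code \<phi>" "poly ?p (length (code \<phi>))" q0 q0 "[]"] K f
      by (simp del: poly_pCons)
    then show ?thesis
      unfolding outputs_within_def by (simp add: transducer_config_def transducer_tm_def)
  qed
  moreover have "is_tm ?M"
    by (rule is_tm_transducer_tm) (rule K)+
  ultimately show ?thesis
    unfolding poly_time_computable_def by blast
qed


section \<open>The translation\<close>

abbreviation p :: fm where "p \<equiv> Var 0"

definition neg :: "fm \<Rightarrow> fm" where "neg \<phi> = Imp \<phi> Bot"
definition land :: "fm \<Rightarrow> fm \<Rightarrow> fm" where "land \<phi> \<psi> = neg (Imp \<phi> (neg \<psi>))"
definition dia :: "fm \<Rightarrow> fm" where "dia \<phi> = neg (Box (neg \<phi>))"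

lemma vars_connectives [simp]:
  "vars (neg \<phi>) = vars \<phi>" "vars (land \<phi> \<psi>) = vars \<phi> \<union> vars \<psi>" "vars (dia \<phi>) = vars \<phi>"
  by (auto simp: neg_def land_def dia_def)

lemma sat_connectives [simp]:
  "sat W R V w (neg \<phi>) \<longleftrightarrow> \<not> sat W R V w \<phi>"
  "sat W R V w (land \<phi> \<psi>) \<longleftrightarrow> sat W R V w \<phi> \<and> sat W R V w \<psi>"
  "sat W R V w (dia \<phi>) \<longleftrightarrow> (\<exists>v\<in>W. (w, v) \<in> R \<and> sat W R V v \<phi>)"
  by (auto simp: neg_def land_def dia_def)

text \<open>
  In the models built below, the formulas \<open>spur\<close> and \<open>peak\<close> tell apart the successive worlds
  X, Y, Z, X, \<dots> of a path, so that a path can be followed in one direction only although the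
  accessibility relation is symmetric; \<open>peak\<close> on an X world gives the digit just passed.
\<close>

definition spur :: fm where "spur = dia (land (neg p) (Box (neg p)))"
definition peak :: fm where "peak = dia (land p (dia (Box p)))"

definition is_Y :: fm where "is_Y = land spur (neg peak)"
definition is_Z :: fm where "is_Z = land spur peak"
text \<open>\<open>neg p\<close> excludes the \<open>Low\<close> neighbours in the models below,
  where \<open>spur\<close> fails as well.\<close>

definition is_X :: "letter \<Rightarrow> fm" where
  "is_X d = land (neg p) (land (neg spur) (if d = D1 then peak else neg peak))"

text \<open>
  All subformulas that depend on the digits are in final position, so in Polish notation every
  digit contributes a fixed word. This is why the variable is coded by the absence of a path.
\<close>

definition digit :: "letter \<Rightarrow> fm \<Rightarrow> fm" where
  "digit d \<phi> = Box (Imp is_Y (Box (Imp is_Z (Box (Imp (is_X d) \<phi>)))))"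

text \<open>The end \<open>dia is_Y\<close> says that the path continues, so a path refutes the
  formula only by spelling \<open>ds\<close> and stopping there. This tells a word from its proper
  extensions.\<close>

definition path :: "letter list \<Rightarrow> fm" where
  "path ds = foldr digit ds (dia is_Y)"

primrec trl :: "fm \<Rightarrow> fm" where
  "trl (Var i) = Box (Imp (neg p) (path (binary i)))"
| "trl Bot = Bot"
| "trl (Imp \<phi> \<psi>) = Imp (trl \<phi>) (trl \<psi>)"
| "trl (Box \<phi>) = Box (Imp p (trl \<phi>))"

definition single_var :: "fm \<Rightarrow> fm" where
  "single_var \<phi> = Imp p (trl \<phi>)"

lemma vars_path: "vars (path ds) = {0}"
  by (induction ds)
    (simp_all add: path_def digit_def is_X_def is_Y_def is_Z_def spur_def peak_def)

lemma vars_trl: "vars (trl \<phi>) \<subseteq> {0}"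
  by (induction \<phi>) (auto simp: vars_path)

lemma single_var_in_single_variable: "single_var \<phi> \<in> single_variable"
proof -
  have "vars (single_var \<phi>) = {0}" using vars_trl by (auto simp: single_var_def)
  then show ?thesis by (simp add: single_variable_def)
qed

section \<open>Computing the translation by a transducer\<close>

text \<open>The state is \<open>None\<close> initially; afterwards it records whether a variable index is being read.\<close>

definition letter_word :: "letter \<Rightarrow> letter list" where
  "letter_word a = (case a of
     LVar \<Rightarrow> LBox # LImp # code (neg p)
   | LBox \<Rightarrow> LBox # LImp # code p
   | _ \<Rightarrow> [a])"

definition digit_word :: "letter \<Rightarrow> letter list" where
  "digit_word d = LBox # LImp # code is_Y @ LBox # LImp # code is_Z @ LBox # LImp # code (is_X d)"

definition single_var_step :: "bool option \<Rightarrow> letter \<Rightarrow> bool option \<times> letter list" where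
  "single_var_step s a =
     (if a \<in> {D0, D1} then (s, digit_word a)
      else (Some (a = LVar),
        (case s of None \<Rightarrow> LImp # code p | Some r \<Rightarrow> if r then code (dia is_Y) else []) @
        letter_word a))"

definition single_var_fin :: "bool option \<Rightarrow> letter list" where
  "single_var_fin s = (if s = Some True then code (dia is_Y) else [])"

lemma transduce_digits:
  assumes "set ds \<subseteq> {D0, D1}"
  shows "transduce single_var_step single_var_fin (Some True) (ds @ xs) =
    concat (map digit_word ds) @ transduce single_var_step single_var_fin (Some True) xs"
  using assms by (induction ds) (auto simp: single_var_step_def)

text \<open>The end of an index shows only at the next letter or at the end of the input; the
  closing \<open>dia is_Y\<close> is emitted there.\<close>

lemma transduce_leave_digits:
  assumes "xs = [] \<or> hd xs \<notin> {D0, D1}"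
  shows "transduce single_var_step single_var_fin (Some True) xs =
    code (dia is_Y) @ transduce single_var_step single_var_fin (Some False) xs"
  using assms by (cases xs) (auto simp: single_var_step_def single_var_fin_def)

lemma code_path: "code (path ds) = concat (map digit_word ds) @ code (dia is_Y)"
  by (induction ds) (simp_all add: path_def digit_def digit_word_def)

text \<open>A digit at the head of \<open>xs\<close> would be read as part of the index of a last
  variable in \<phi>. Inside an implication \<open>hd_code\<close> excludes this.\<close>

lemma transduce_code:
  assumes "xs = [] \<or> hd xs \<notin> {D0, D1}"
  shows "transduce single_var_step single_var_fin (Some False) (code \<phi> @ xs) =
    code (trl \<phi>) @ transduce single_var_step single_var_fin (Some False) xs"
  using assms
proof (induction \<phi> arbitrary: xs)
  case (Var i)
  have "transduce single_var_step single_var_fin (Some False) (LVar # ds) =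
      LBox # LImp # code (neg p) @ transduce single_var_step single_var_fin (Some True) ds" for ds
    by (simp add: single_var_step_def letter_word_def)
  then show ?case
    using transduce_leave_digits[OF Var] by (simp add: transduce_digits[OF binary_digits] code_path)
next
  case (Imp \<phi> \<psi>)
  then show ?case
    using hd_code[of \<psi>] by (simp add: single_var_step_def letter_word_def)
qed (simp_all add: single_var_step_def letter_word_def)

lemma code_single_var: "code (single_var \<phi>) = transduce single_var_step single_var_fin None (code \<phi>)"
proof -
  have start: "transduce single_var_step single_var_fin None xs =
      LImp # code p @ transduce single_var_step single_var_fin (Some False) xs"
    if "xs \<noteq> [] \<and> hd xs \<notin> {D0, D1}" for xs
    using that by (cases xs) (auto simp: single_var_step_def)
  show ?thesis
    using transduce_code[of "[]" \<phi>] start[OF hd_code[of \<phi>]]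
    by (simp add: single_var_def single_var_fin_def)
qed

section \<open>Restriction to the worlds of \<open>p\<close>\<close>

lemma sat_trl_restrict:
  fixes V :: "nat \<Rightarrow> 'w set"
  assumes V: "\<And>i. V i \<subseteq> W" and "x \<in> V 0"
  shows "sat (V 0) (R \<inter> V 0 \<times> V 0) (\<lambda>i :: nat. {x \<in> V 0. sat W R V x (trl (Var i))}) x \<phi> \<longleftrightarrow>
    sat W R V x (trl \<phi>)"
  using assms(2)
proof (induction \<phi> arbitrary: x)
  case (Box \<phi>)
  then show ?case using V[of 0] by auto
qed auto

text \<open>The hypothesis is about subframes because the frame classes of both logics are closed
  under them.\<close>

lemma single_var_valid:
  fixes W :: "'w set"
  assumes "\<And>W'. W' \<subseteq> W \<Longrightarrow> W' \<noteq> {} \<Longrightarrow> valid_on W' (R \<inter> W' \<times> W') \<phi>"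
  shows "valid_on W R (single_var \<phi>)"
  unfolding valid_on_def
proof (intro allI impI ballI)
  fix V :: "nat \<Rightarrow> 'w set" and w assume V: "\<forall>i. V i \<subseteq> W" and w: "w \<in> W"
  let ?V = "\<lambda>i. {x \<in> V 0. sat W R V x (trl (Var i))}"
  have "sat W R V w (trl \<phi>)" if w0: "w \<in> V 0"
  proof -
    have "valid_on (V 0) (R \<inter> V 0 \<times> V 0) \<phi>" using assms[of "V 0"] V w0 by auto
    then have "sat (V 0) (R \<inter> V 0 \<times> V 0) ?V w \<phi>"
      using w0 unfolding valid_on_def by (elim allE[of _ ?V]) blast
    then show ?thesis using sat_trl_restrict[of V W w R \<phi>] V w0 by blast
  qed
  then show "sat W R V w (single_var \<phi>)" by (simp add: single_var_def)
qed


section \<open>Eliminating variables from a countermodel\<close>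

text \<open>
  The path \<open>Spine x i\<close> goes on forever; its end as a code word is where the worlds of phase Y
  stop satisfying \<open>spur\<close>. The \<open>Low\<close> worlds make \<open>\<not> p \<and> Box (\<not> p)\<close> fail on the path itself.
\<close>

datatype phase = X | Y | Z

datatype 'w node =
    Real (owner: 'w)
  | Spine (owner: 'w) nat phase nat
  | Low (owner: 'w) nat phase nat
  | High (owner: 'w) nat phase nat
  | Spur (owner: 'w) nat phase nat

fun has_spur :: "nat \<Rightarrow> phase \<Rightarrow> nat \<Rightarrow> bool" where
  "has_spur i X j \<longleftrightarrow> False"
| "has_spur i Y j \<longleftrightarrow> j < length (binary i)"
| "has_spur i Z j \<longleftrightarrow> j < length (binary i)"

text \<open>Digit number \<open>k\<close> is carried by the X world \<open>Suc k\<close>, which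
  follows Y and Z number \<open>k\<close>; X number 0 carries none.\<close>

fun has_peak :: "nat \<Rightarrow> phase \<Rightarrow> nat \<Rightarrow> bool" where
  "has_peak i X j \<longleftrightarrow> (\<exists>k. j = Suc k \<and> k < length (binary i) \<and> binary i ! k = D1)"
| "has_peak i Y j \<longleftrightarrow> False"
| "has_peak i Z j \<longleftrightarrow> True"

section \<open>The extended model and its frame conditions\<close>

locale kripke_model =
  fixes W :: "'w set" and R :: "('w \<times> 'w) set" and V :: "nat \<Rightarrow> 'w set"
  assumes frame: "R \<subseteq> W \<times> W"
begin

text \<open>The path of a variable true at \<open>x\<close> exists too but is not joined to
  \<open>Real x\<close>.\<close>

fun pred_nodes :: "'w \<Rightarrow> nat \<Rightarrow> phase \<Rightarrow> nat \<Rightarrow> 'w node set" where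
  "pred_nodes x i X 0 = (if x \<in> V i then {} else {Real x})"
| "pred_nodes x i X (Suc j) = {Spine x i Z j}"
| "pred_nodes x i Y j = {Spine x i X j}"
| "pred_nodes x i Z j = {Spine x i Y j}"

fun succ_node :: "'w \<Rightarrow> nat \<Rightarrow> phase \<Rightarrow> nat \<Rightarrow> 'w node" where
  "succ_node x i X j = Spine x i Y j"
| "succ_node x i Y j = Spine x i Z j"
| "succ_node x i Z j = Spine x i X (Suc j)"

fun nbrs :: "'w node \<Rightarrow> 'w node set" where
  "nbrs (Real x) = Real ` (R `` {x}) \<union> (\<lambda>i. Spine x i X 0) ` {i. x \<notin> V i}"
| "nbrs (Spine x i s j) =
    pred_nodes x i s j \<union> {Spine x i s j, succ_node x i s j, Low x i s j, Spur x i s j}"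
| "nbrs (Low x i s j) = {Low x i s j, Spine x i s j, High x i s j}"
| "nbrs (High x i s j) = {High x i s j, Low x i s j}"
| "nbrs (Spur x i s j) = {Spur x i s j, Spine x i s j}"

definition nodes :: "'w node set" where
  "nodes = {u. owner u \<in> W}"

definition edges :: "('w node \<times> 'w node) set" where
  "edges = {(u, v). u \<in> nodes \<and> v \<in> nbrs u}"

text \<open>All spine worlds carry the same attachments; \<open>p\<close> at \<open>High\<close>
  decides \<open>peak\<close> by way of \<open>Low\<close>, and \<open>p\<close> at
  \<open>Spur\<close> decides \<open>spur\<close>.\<close>

fun p_holds :: "'w node \<Rightarrow> bool" where
  "p_holds (Real x) \<longleftrightarrow> True"
| "p_holds (Spine x i s j) \<longleftrightarrow> False"
| "p_holds (Low x i s j) \<longleftrightarrow> True"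
| "p_holds (High x i s j) \<longleftrightarrow> has_peak i s j"
| "p_holds (Spur x i s j) \<longleftrightarrow> \<not> has_spur i s j"

definition val :: "nat \<Rightarrow> 'w node set" where
  "val i = {u \<in> nodes. p_holds u}"

abbreviation holds :: "'w node \<Rightarrow> fm \<Rightarrow> bool" where
  "holds \<equiv> sat nodes edges val"

lemma nbrs_nodes: "u \<in> nodes \<Longrightarrow> v \<in> nbrs u \<Longrightarrow> v \<in> nodes"
  using frame
  \<comment> \<open>The second split serves the \<open>Spine\<close> case; for other
    \<open>u\<close> it splits an unspecified tuple, harmlessly.\<close>
  by (cases u; cases "(case u of Spine x i s j \<Rightarrow> (x, i, s, j))" rule: pred_nodes.cases)
    (auto simp: nodes_def split: if_splits)

lemma holds_p [simp]: "u \<in> nodes \<Longrightarrow> holds u p \<longleftrightarrow> p_holds u"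
  by (simp add: val_def)

lemma holds_Box: "u \<in> nodes \<Longrightarrow> holds u (Box \<phi>) \<longleftrightarrow> (\<forall>v\<in>nbrs u. holds v \<phi>)"
  using nbrs_nodes[of u] by (auto simp: edges_def)

lemma holds_dia: "u \<in> nodes \<Longrightarrow> holds u (dia \<phi>) \<longleftrightarrow> (\<exists>v\<in>nbrs u. holds v \<phi>)"
  using nbrs_nodes[of u] by (auto simp: edges_def)

lemma is_frame_nodes: "W \<noteq> {} \<Longrightarrow> is_frame nodes edges"
  using nbrs_nodes by (force simp: is_frame_def edges_def nodes_def intro: exI[of _ "Real _"])

lemma refl_on_nodes:
  assumes "refl_on W R"
  shows "refl_on nodes edges"
proof (rule refl_onI)
  fix u assume "u \<in> nodes"
  then show "(u, u) \<in> edges"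
    using refl_onD[OF assms] by (cases u) (auto simp: edges_def nodes_def)
qed

lemma sym_edges:
  assumes "sym R"
  shows "sym edges"
proof (rule symI)
  fix u v assume uv: "(u, v) \<in> edges"
  have "u \<in> nbrs v"
    if "v \<in> nbrs u" using that
  proof (cases u)
    case (Spine x i s j)
    then show ?thesis using that
      by (cases "(x, i, s, j)" rule: pred_nodes.cases) (auto split: if_splits)
  qed (use that symD[OF assms] in auto)
  then show "(v, u) \<in> edges"
    using uv nbrs_nodes by (auto simp: edges_def)
qed

section \<open>Truth on the attached worlds\<close>

lemma spine_nodes [simp]:
  assumes "x \<in> W"
  shows "Real x \<in> nodes" "Spine x i s j \<in> nodes" "Low x i s j \<in> nodes" "High x i s j \<in> nodes"
    "Spur x i s j \<in> nodes"
  using assms by (simp_all add: nodes_def)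

lemma Box_neg_p:
  assumes "x \<in> W"
  shows "\<not> holds (Spine x i s j) (Box (neg p))" "\<not> holds (High x i s j) (Box (neg p))"
    "holds (Spur x i s j) (Box (neg p)) \<longleftrightarrow> has_spur i s j"
  using assms by (auto simp: holds_Box simp del: sat.simps)

lemma Box_p:
  assumes "x \<in> W"
  shows "\<not> holds (Spine x i s j) (Box p)" "\<not> holds (Low x i s j) (Box p)"
    "\<not> holds (Spur x i s j) (Box p)" "holds (High x i s j) (Box p) \<longleftrightarrow> has_peak i s j"
  using assms by (auto simp: holds_Box simp del: sat.simps)

lemma holds_spur:
  assumes "x \<in> W"
  shows "\<not> holds (Real x) spur" "holds (Spine x i s j) spur \<longleftrightarrow> has_spur i s j"
    "\<not> holds (Low x i s j) spur" "holds (Spur x i s j) spur \<longleftrightarrow> has_spur i s j"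
proof -
  have R: "y \<in> W" if "(x, y) \<in> R" for y using that frame by auto
  show "\<not> holds (Real x) spur" "\<not> holds (Low x i s j) spur"
    "holds (Spur x i s j) spur \<longleftrightarrow> has_spur i s j"
    using assms R by (auto simp: spur_def holds_dia Box_neg_p simp del: sat.simps sat_connectives(3))
  show "holds (Spine x i s j) spur \<longleftrightarrow> has_spur i s j"
    using assms by (cases "(x, i, s, j)" rule: pred_nodes.cases)
      (auto simp: spur_def holds_dia Box_neg_p simp del: sat.simps sat_connectives(3) split: if_splits)
qed

text \<open>X number 0 is exempt: its possible neighbour \<open>Real x\<close> satisfies
  \<open>p\<close> and may see a \<open>Real\<close> world with \<open>Box p\<close>. Its digit is
  never tested, and \<open>is_Y\<close> and \<open>is_Z\<close> fail there for lack of
  \<open>spur\<close>.\<close>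

lemma holds_peak:
  assumes "x \<in> W"
  shows "s \<noteq> X \<or> j \<noteq> 0 \<Longrightarrow> holds (Spine x i s j) peak \<longleftrightarrow> has_peak i s j"
    "\<not> holds (Spur x i s j) peak"
proof -
  have low: "holds (Low x i s j) (dia (Box p)) \<longleftrightarrow> has_peak i s j" for s j
    using assms by (auto simp: holds_dia Box_p simp del: sat.simps sat_connectives(3))
  have spur: "\<not> holds (Spur x i s j) (dia (Box p))" for s j
    using assms by (auto simp: holds_dia Box_p simp del: sat.simps sat_connectives(3))
  show "\<not> holds (Spur x i s j) peak"
    using assms unfolding peak_def
    by (auto simp: holds_dia[of "Spur x i s j"] spur simp del: sat.simps sat_connectives(3))
  show "holds (Spine x i s j) peak \<longleftrightarrow> has_peak i s j" if "s \<noteq> X \<or> j \<noteq> 0"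
    using assms that unfolding peak_def
    by (cases "(x, i, s, j)" rule: pred_nodes.cases)
      (auto simp: holds_dia[of "Spine _ _ _ _"] low spur simp del: sat.simps sat_connectives(3))
qed

text \<open>A \<open>Spur\<close> world sees itself, so it satisfies \<open>is_Y\<close> whenever
  \<open>has_spur\<close> holds. At X worlds, where \<open>is_Y\<close> is tested,
  \<open>has_spur\<close> is false.\<close>

lemma holds_is_Y:
  assumes "x \<in> W"
  shows "\<not> holds (Real x) is_Y" "\<not> holds (Low x i s j) is_Y"
    "holds (Spine x i s j) is_Y \<longleftrightarrow> s = Y \<and> j < length (binary i)"
    "holds (Spur x i s j) is_Y \<longleftrightarrow> has_spur i s j"
  using assms by (cases s; auto simp: is_Y_def holds_spur holds_peak simp del: sat.simps)+

lemma holds_is_Z: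
  assumes "x \<in> W"
  shows "\<not> holds (Low x i s j) is_Z" "\<not> holds (Spur x i s j) is_Z"
    "holds (Spine x i s j) is_Z \<longleftrightarrow> s = Z \<and> j < length (binary i)"
  using assms by (cases s; auto simp: is_Z_def holds_spur holds_peak simp del: sat.simps)+

lemma holds_is_X:
  assumes "x \<in> W"
  shows "\<not> holds (Low x i s j) (is_X d)"
    "has_spur i s j \<Longrightarrow> \<not> holds (Spine x i s j) (is_X d)"
    "has_spur i s j \<Longrightarrow> \<not> holds (Spur x i s j) (is_X d)"
    "j < length (binary i) \<Longrightarrow>
      holds (Spine x i X (Suc j)) (is_X d) \<longleftrightarrow> (binary i ! j = D1 \<longleftrightarrow> d = D1)"
  using assms by (auto simp: is_X_def holds_spur holds_peak simp del: sat.simps)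

text \<open>The only neighbours passing the successive tests are Y, Z and the next X, so the formula
  compares \<open>ds\<close> with the remaining digits.\<close>

lemma holds_path:
  assumes "x \<in> W" "set ds \<subseteq> {D0, D1}" "j \<le> length (binary i)"
  shows "holds (Spine x i X j) (path ds) \<longleftrightarrow> ds \<noteq> drop j (binary i)"
  using assms(2,3)
proof (induction ds arbitrary: j)
  case Nil
  have "holds (Spine x i X j) (path []) \<longleftrightarrow> j < length (binary i)"
    using assms(1) unfolding path_def
    by (cases j) (auto simp: holds_dia holds_is_Y simp del: sat.simps sat_connectives(3))
  then show ?case by auto
next
  case (Cons d ds)
  let ?X = "Box (Imp (is_X d) (path ds))" and ?l = "length (binary i)"
  let ?Z = "Box (Imp is_Z ?X)"
  have unf: "path (d # ds) = Box (Imp is_Y ?Z)" by (simp add: path_def digit_def)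
  have "holds (Spine x i X j) (path (d # ds)) \<longleftrightarrow> (j < ?l \<longrightarrow> holds (Spine x i Y j) ?Z)"
    unfolding unf using assms(1)
    by (cases j) (auto simp: holds_Box[of "Spine x i X _"] holds_is_Y simp del: sat.simps(4))
  moreover have "holds (Spine x i Y j) ?Z \<longleftrightarrow> holds (Spine x i Z j) ?X" if "j < ?l"
    using assms(1) that
    by (auto simp: holds_Box[of "Spine x i Y _"] holds_is_Z simp del: sat.simps(4))
  moreover have "holds (Spine x i Z j) ?X \<longleftrightarrow>
      ((binary i ! j = D1 \<longleftrightarrow> d = D1) \<longrightarrow> ds \<noteq> drop (Suc j) (binary i))" if "j < ?l"
    using assms(1) that Cons
    by (auto simp: holds_Box[of "Spine x i Z _"] holds_is_X simp del: sat.simps(4))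
  \<comment> \<open>\<open>is_X\<close> only tests for \<open>D1\<close>, which suffices as both
    words consist of \<open>D0\<close> and \<open>D1\<close>.\<close>
  moreover have "(binary i ! j = D1 \<longleftrightarrow> d = D1) \<longleftrightarrow> binary i ! j = d" if "j < ?l"
    using Cons.prems(1) binary_digits[of i] nth_mem[OF that] by auto
  ultimately have "holds (Spine x i X j) (path (d # ds)) \<longleftrightarrow>
      (j < ?l \<longrightarrow> binary i ! j = d \<longrightarrow> ds \<noteq> drop (Suc j) (binary i))"
    by blast
  then show ?case
    by (cases "j < ?l") (auto simp: Cons_nth_drop_Suc[symmetric])
qed

lemma holds_trl:
  assumes "x \<in> W"
  shows "holds (Real x) (trl \<phi>) \<longleftrightarrow> sat W R V x \<phi>"
  using assms
proof (induction \<phi> arbitrary: x)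
  case (Var i)
  have R: "y \<in> W" if "(x, y) \<in> R" for y using that frame by auto
  \<comment> \<open>Path \<open>k\<close> refutes the formula for \<open>i\<close> only if the
    binary words agree, that is, if the indices do.\<close>
  have "holds (Spine x k X 0) (path (binary i)) \<longleftrightarrow> i \<noteq> k" for k
    using holds_path[OF Var binary_digits, of 0 k i] inj_binary[of i k] by auto
  then have "holds (Real x) (trl (Var i)) \<longleftrightarrow> (\<forall>k. x \<notin> V k \<longrightarrow> i \<noteq> k)"
    using Var R by (auto simp: holds_Box[of "Real x"] ball_Un simp del: sat.simps(1,4))
  then show ?case by auto
next
  case (Box \<phi>)
  have R: "y \<in> W" if "(x, y) \<in> R" for y using that frame by auto
  have "holds (Real x) (trl (Box \<phi>)) \<longleftrightarrow> (\<forall>y. (x, y) \<in> R \<longrightarrow> sat W R V y \<phi>)"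
    using Box.prems R
    by (auto simp: holds_Box[of "Real x"] ball_Un Box.IH simp del: sat.simps(1,4))
  then show ?case using R by auto
qed auto

lemma single_var_reflect:
  assumes "valid_on nodes edges (single_var \<phi>)" "x \<in> W"
  shows "sat W R V x \<phi>"
proof -
  have "\<forall>i. val i \<subseteq> nodes" by (auto simp: val_def)
  then have "holds (Real x) (single_var \<phi>)"
    using assms spine_nodes(1)[OF assms(2)] unfolding valid_on_def by blast
  then show ?thesis using assms(2) by (simp add: single_var_def holds_trl val_def)
qed

end

section \<open>The embedding for both logics\<close>

theorem theorem2:
  fixes L :: "fm set"
  assumes "L \<in> {logic_K, logic_KTB}"
  shows "\<exists>e :: fm \<Rightarrow> fm. poly_time_computable e \<and>
           (\<forall>\<phi>. e \<phi> \<in> single_variable) \<and>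
           (\<forall>\<phi>. \<phi> \<in> L \<longleftrightarrow> e \<phi> \<in> L)"
proof -
  have K: "\<phi> \<in> logic_K \<longleftrightarrow> single_var \<phi> \<in> logic_K" for \<phi>
  proof
    assume f: "\<phi> \<in> logic_K"
    show "single_var \<phi> \<in> logic_K"
      unfolding logic_K_def
      by (intro CollectI allI impI single_var_valid logic_K_valid[OF f]) (simp add: is_frame_def)
  next
    assume e: "single_var \<phi> \<in> logic_K"
    have "sat W R V x \<phi>" if "is_frame W R" "x \<in> W" for W :: "nat set" and R V x
    proof -
      interpret kripke_model W R V using that(1) by unfold_locales (simp add: is_frame_def)
      show ?thesis
        using single_var_reflect logic_K_valid[OF e is_frame_nodes] that(2) by blast
    qed
    then show "\<phi> \<in> logic_K" by (simp add: logic_K_def valid_on_def)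
  qed
  have KTB: "\<phi> \<in> logic_KTB \<longleftrightarrow> single_var \<phi> \<in> logic_KTB" for \<phi>
  proof
    assume f: "\<phi> \<in> logic_KTB"
    show "single_var \<phi> \<in> logic_KTB"
      unfolding logic_KTB_def
    proof (intro CollectI allI impI single_var_valid)
      fix W W' :: "nat set" and R
      assume "is_frame W R \<and> refl_on W R \<and> sym R" "W' \<subseteq> W" "W' \<noteq> {}"
      then show "valid_on W' (R \<inter> W' \<times> W') \<phi>"
        by (intro logic_KTB_valid[OF f]) (auto simp: is_frame_def refl_on_def sym_def)
    qed
  next
    assume e: "single_var \<phi> \<in> logic_KTB"
    have "sat W R V x \<phi>" if "is_frame W R" "refl_on W R" "sym R" "x \<in> W"
      for W :: "nat set" and R V x
    proof -
      interpret kripke_model W R V using that(1) by unfold_locales (simp add: is_frame_def)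
      show ?thesis
        using single_var_reflect logic_KTB_valid[OF e is_frame_nodes refl_on_nodes sym_edges] that
        by blast
    qed
    then show "\<phi> \<in> logic_KTB" by (simp add: logic_KTB_def valid_on_def)
  qed
  have "poly_time_computable single_var"
    using code_single_var by (rule poly_time_computable_transduce)
  then show ?thesis
    using assms single_var_in_single_variable K KTB by blast
qed

end
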